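(* Let $X$ be a hereditarily decomposable continuum with at least one free arc. For any $p\in X$, there exist a continuum $Y$ that is not hereditarily decomposable and a point $q\in Y$ such that $C(p,X)$ and $C(q,Y)$ are homeomorphic.
   Context: A continuum is a nonempty compact connected metric space. $C(X)$ is the set of all subcontinua of $X$ (nonempty closed connected subsets), and for $p\in X$, $C(p,X)=\{A\in C(X): p\in A\}$, endowed with the Hausdorff metric. A continuum $X$ is decomposable if there exist $A,B\in C(X)\setminus\{X\}$ with $X=A\cup B$. $X$ is hereditarily decomposable if every $C\in C(X)$ with $|C|>1$ is decomposable. A free arc in a continuum $X$ is an arc $A\subset X$ (a subset homeomorphic to $[0,1]$) such that every point of $A$ other than its two end points belongs to the interior of $A$ in $X$. *)

theory Defs
  imports "HOL-Analysis.Analysis"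
begin

text \<open>Metric spaces are rendered as subsets of types of class \<^class>\<open>metric_space\<close>, with the
  restricted metric.  An existential quantifier over continua is rendered over subsets of
  \<^typ>\<open>nat \<Rightarrow> real\<close>, whose library metric induces the product topology: every compact
  metric space is homeomorphic to such a subset.\<close>

definition continuum :: "'a::metric_space set \<Rightarrow> bool" where
  "continuum X \<longleftrightarrow> X \<noteq> {} \<and> compact X \<and> connected X"

definition subcontinua :: "'a::metric_space set \<Rightarrow> 'a set set" where
  "subcontinua X = {A. A \<noteq> {} \<and> closedin (top_of_set X) A \<and> connected A}"

definition subcontinua_at :: "'a::metric_space \<Rightarrow> 'a set \<Rightarrow> 'a set set" where
  "subcontinua_at p X = {A \<in> subcontinua X. p \<in> A}"

definition decomposable :: "'a::metric_space set \<Rightarrow> bool" where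
  "decomposable X \<longleftrightarrow> (\<exists>A \<in> subcontinua X - {X}. \<exists>B \<in> subcontinua X - {X}. X = A \<union> B)"

text \<open>The condition \<open>|C| > 1\<close> is spelled out with two points because \<^const>\<open>card\<close> is \<open>0\<close> on
  infinite sets.\<close>

definition hereditarily_decomposable :: "'a::metric_space set \<Rightarrow> bool" where
  "hereditarily_decomposable X \<longleftrightarrow>
     (\<forall>C \<in> subcontinua X. (\<exists>x\<in>C. \<exists>y\<in>C. x \<noteq> y) \<longrightarrow> decomposable C)"

definition free_arc :: "'a::metric_space set \<Rightarrow> 'a set \<Rightarrow> bool" where
  "free_arc X A \<longleftrightarrow> A \<subseteq> X \<and>
     (\<exists>g h. homeomorphism {0..1::real} A g h \<and>
        (\<forall>x \<in> A - {g 0, g 1}. x \<in> (top_of_set X) interior_of A))"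

text \<open>The value \<open>0\<close> on sets that are empty or unbounded is a dummy one, which makes the function
  symmetric and nonnegative everywhere, as the locale \<^locale>\<open>Metric_space\<close> demands.\<close>

definition hausdorff_dist :: "'a::metric_space set \<Rightarrow> 'a set \<Rightarrow> real" where
  "hausdorff_dist A B =
     (if A \<noteq> {} \<and> B \<noteq> {} \<and> bounded A \<and> bounded B
      then max (SUP a\<in>A. infdist a B) (SUP b\<in>B. infdist b A) else 0)"

definition subcontinua_at_top :: "'a::metric_space \<Rightarrow> 'a set \<Rightarrow> 'a set topology" where
  "subcontinua_at_top p X = Metric_space.mtopology (subcontinua_at p X) hausdorff_dist"

lemma bdd_above_infdist:
  assumes "bounded A" "B \<noteq> {}"
  shows "bdd_above ((\<lambda>a. infdist a B) ` A)"
proof -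
  obtain b where b: "b \<in> B" using assms by blast
  obtain e where "\<forall>a\<in>A. dist b a \<le> e" using assms(1) bounded_any_center by metis
  then have "infdist a B \<le> e" if "a \<in> A" for a
    using infdist_le[OF b, of a] that by (metis dist_commute order_trans)
  then show ?thesis by (rule bdd_aboveI2)
qed

lemma hausdorff_dist_commute: "hausdorff_dist A B = hausdorff_dist B A"
  by (auto simp: hausdorff_dist_def max.commute)

lemma hausdorff_dist_nonneg: "0 \<le> hausdorff_dist A B"
proof (cases "A \<noteq> {} \<and> B \<noteq> {} \<and> bounded A \<and> bounded B")
  case True
  then obtain a where a: "a \<in> A" by blast
  have "0 \<le> infdist a B" by (rule infdist_nonneg)
  also have "\<dots> \<le> (SUP a\<in>A. infdist a B)"
    using True a by (intro cSUP_upper bdd_above_infdist) auto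
  finally show ?thesis using True by (auto simp: hausdorff_dist_def)
qed (auto simp: hausdorff_dist_def)

lemma infdist_le_hausdorff_dist:
  assumes "a \<in> A" "B \<noteq> {}" "bounded A" "bounded B"
  shows "infdist a B \<le> hausdorff_dist A B"
proof -
  have "infdist a B \<le> (SUP a\<in>A. infdist a B)"
    using assms by (intro cSUP_upper bdd_above_infdist)
  then show ?thesis using assms by (auto simp: hausdorff_dist_def)
qed

lemma hausdorff_dist_le:
  assumes "A \<noteq> {}" "B \<noteq> {}" "\<And>a. a \<in> A \<Longrightarrow> infdist a B \<le> r" "\<And>b. b \<in> B \<Longrightarrow> infdist b A \<le> r"
    "bounded A" "bounded B"
  shows "hausdorff_dist A B \<le> r"
  using assms by (auto simp: hausdorff_dist_def intro!: cSUP_least)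

lemma infdist_triangle_hausdorff_dist:
  assumes "a \<in> A" "compact A" "compact B" "B \<noteq> {}" "compact C" "C \<noteq> {}"
  shows "infdist a C \<le> hausdorff_dist A B + hausdorff_dist B C"
proof -
  obtain b where b: "b \<in> B" "infdist a B = dist a b"
  proof -
    obtain b where b: "b \<in> B" "\<And>y. y \<in> B \<Longrightarrow> dist a b \<le> dist a y"
      using continuous_attains_inf[of B "\<lambda>y. dist a y",
          OF _ _ continuous_on_dist[OF continuous_on_const continuous_on_id]] assms by auto
    then have "dist a b \<le> infdist a B"
      using assms by (auto simp: infdist_notempty intro!: cINF_greatest)
    with b infdist_le[OF b(1), of a] show thesis by (intro that[of b]) auto
  qed
  have "infdist a C \<le> infdist b C + dist a b"
    by (rule infdist_triangle)
  moreover have "infdist b C \<le> hausdorff_dist B C"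
    using assms b by (intro infdist_le_hausdorff_dist) (auto simp: compact_imp_bounded)
  moreover have "dist a b \<le> hausdorff_dist A B"
    using assms infdist_le_hausdorff_dist[of a A B] b by (auto simp: compact_imp_bounded)
  ultimately show ?thesis by linarith
qed

lemma Metric_space_hausdorff_dist:
  assumes "\<And>A. A \<in> \<A> \<Longrightarrow> A \<noteq> {} \<and> compact A"
  shows "Metric_space \<A> hausdorff_dist"
proof
  fix A B :: "'a set"
  show "0 \<le> hausdorff_dist A B" by (rule hausdorff_dist_nonneg)
  show "hausdorff_dist A B = hausdorff_dist B A" by (rule hausdorff_dist_commute)
next
  have sub: "A \<subseteq> B" if "hausdorff_dist A B = 0" "A \<noteq> {}" "compact A" "B \<noteq> {}" "compact B"
    for A B :: "'a set"
  proof
    fix a assume "a \<in> A"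
    then have "infdist a B \<le> 0"
      using infdist_le_hausdorff_dist[of a A B] that by (simp add: compact_imp_bounded)
    then have "infdist a B = 0" using infdist_nonneg[of a B] by linarith
    then show "a \<in> B"
      using that in_closed_iff_infdist_zero compact_imp_closed by blast
  qed
  fix A B assume A: "A \<in> \<A>" and B: "B \<in> \<A>"
  have "hausdorff_dist A A \<le> 0"
    using assms[OF A] by (intro hausdorff_dist_le) (auto simp: compact_imp_bounded)
  then have "hausdorff_dist A A = 0" using hausdorff_dist_nonneg[of A A] by linarith
  then show "hausdorff_dist A B = 0 \<longleftrightarrow> A = B"
    using sub[of A B] sub[of B A] assms[OF A] assms[OF B] hausdorff_dist_commute by (metis subset_antisym)
next
  fix A B C assume "A \<in> \<A>" "B \<in> \<A>" "C \<in> \<A>"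
  note * = assms[OF this(1)] assms[OF this(2)] assms[OF this(3)]
  have 2: "infdist c A \<le> hausdorff_dist A B + hausdorff_dist B C" if "c \<in> C" for c
    using infdist_triangle_hausdorff_dist[of c C B A] * that
    by (simp add: hausdorff_dist_commute add.commute)
  show "hausdorff_dist A C \<le> hausdorff_dist A B + hausdorff_dist B C"
    using * 2 infdist_triangle_hausdorff_dist[of _ A B C]
    by (intro hausdorff_dist_le) (auto simp: compact_imp_bounded)
qed

lemma Metric_space_subcontinua_at:
  assumes "continuum X"
  shows "Metric_space (subcontinua_at p X) hausdorff_dist"
  using assms
  by (intro Metric_space_hausdorff_dist)
     (auto simp: subcontinua_at_def subcontinua_def continuum_def closedin_compact)

end

theory Submission
  imports Defs
begin

text \<open>Choose a point \<open>m\<close> of \<open>X\<close> other than \<open>p\<close> and blow it up to an indecomposable continuum \<open>K\<close>: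
  \<open>Y\<close> consists of \<open>{m} \<times> K\<close> and of the graph of a map \<open>g\<close> from \<open>X - {m}\<close> to \<open>K\<close>, where \<open>g x\<close> depends
  only on the distance \<open>r\<close> of \<open>x\<close> and \<open>m\<close> and oscillates along a dense ray of \<open>K\<close> so wildly that it comes
  close to every point of \<open>K\<close> for arbitrarily small \<open>r\<close>.  A subcontinuum of \<open>Y\<close> that contains the point
  over \<open>p\<close> and meets \<open>{m} \<times> K\<close> projects to a nondegenerate connected subset of \<open>X\<close> through \<open>m\<close>; this
  subset has points at every small distance from \<open>m\<close>, so the subcontinuum contains all of \<open>{m} \<times> K\<close>.
  Hence the projection of \<open>Y\<close> onto \<open>X\<close>, all of whose fibres are connected, induces a homeomorphism
  of the hyperspaces.\<close>

subsection \<open>Embedding into sequence space\<close>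


text \<open>The final continuum has to lie in \<open>nat \<Rightarrow> real\<close>, whereas the
  blow-up lies in a product type. The coordinates of \<open>e\<close> are the distances to the
  points of a countable dense set, which separate points.\<close>

lemma compact_embedding_real_sequences:
  fixes X :: "'a::metric_space set"
  assumes "compact X" "X \<noteq> {}"
  obtains e :: "'a \<Rightarrow> nat \<Rightarrow> real" where "continuous_on X e" "inj_on e X"
proof -
  have "\<exists>K. finite K \<and> K \<subseteq> X \<and> X \<subseteq> (\<Union>x\<in>K. ball x (inverse (real (Suc n))))" for n
    using assms(1) compactE_image[of X X "\<lambda>x. ball x (inverse (real (Suc n)))"]
    by (metis UN_I centre_in_ball inverse_positive_iff_positive of_nat_0_less_iff open_ball subsetI
        zero_less_Suc)
  then obtain K where K: "\<And>n. finite (K n)" "\<And>n. K n \<subseteq> X"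
      "\<And>n. X \<subseteq> (\<Union>x\<in>K n. ball x (inverse (real (Suc n))))"
    by metis
  define D where "D = (\<Union>n. K n)"
  have D: "countable D" unfolding D_def using K(1) by (auto intro: countable_finite)
  have "K 0 \<noteq> {}" using K(3)[of 0] assms(2) by auto
  then have "D \<noteq> {}" by (auto simp: D_def)
  define e where "e = (\<lambda>x n. dist x (from_nat_into D n))"
  show thesis
  proof (rule that)
    show "continuous_on X e"
      unfolding e_def by (intro continuous_intros)
    show "inj_on e X"
    proof (rule inj_onI, rule ccontr)
      fix x y assume xy: "x \<in> X" "y \<in> X" "e x = e y" "x \<noteq> y"
      \<comment> \<open>A net point \<open>z\<close> closer than \<open>dist x y / 2\<close> to
        \<open>x\<close> would be equally close to \<open>y\<close>, against the triangle
        inequality.\<close>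
      then obtain n where n: "inverse (real (Suc n)) < dist x y / 2"
        using reals_Archimedean[of "dist x y / 2"] by auto
      obtain z where z: "z \<in> K n" "dist x z < inverse (real (Suc n))"
        using K(3)[of n] xy(1) by (auto simp: dist_commute)
      then obtain i where "z = from_nat_into D i"
        using D from_nat_into_surj[of D z] by (auto simp: D_def)
      then have "dist x z = dist y z"
        using fun_cong[OF xy(3), of i] by (simp add: e_def)
      then show False using n z dist_triangle2[of x y z] by linarith
    qed
  qed
qed

subsection \<open>Maps between hyperspaces\<close>

text \<open>The points of \<open>Y\<close> at distance at least \<open>e\<close> from
  \<open>A\<close> form a compact set; if it is nonempty, the distance of \<open>f y\<close> to
  \<open>B\<close> has a positive minimum on it, which serves as \<open>d\<close>. With
  \<open>A\<close> a full preimage this gives upper semicontinuity of the preimage, with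
  \<open>A\<close> a one-point fibre it controls \<open>f\<close> near that fibre.\<close>

lemma preimage_near:
  fixes f :: "'a::metric_space \<Rightarrow> 'b::metric_space"
  assumes "compact Y" "continuous_on Y f" "closed B" "B \<noteq> {}"
    and "\<And>y. y \<in> Y \<Longrightarrow> f y \<in> B \<Longrightarrow> y \<in> A" and "e > 0"
  obtains d where "d > 0" "\<And>y. y \<in> Y \<Longrightarrow> infdist (f y) B < d \<Longrightarrow> infdist y A < e"
proof (cases "{y \<in> Y. e \<le> infdist y A} = {}")
  case True
  then show thesis using that[of 1] by (auto simp: not_le)
next
  case False
  have "{y \<in> Y. e \<le> infdist y A} = Y \<inter> {y. e \<le> infdist y A}" by auto
  moreover have "closed {y. e \<le> infdist y A}"
    by (intro closed_Collect_le continuous_intros)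
  ultimately have "compact {y \<in> Y. e \<le> infdist y A}"
    using assms(1) by (simp add: compact_Int_closed)
  moreover have cont: "continuous_on {y \<in> Y. e \<le> infdist y A} (\<lambda>y. infdist (f y) B)"
    by (intro continuous_intros continuous_on_subset[OF assms(2)]) auto
  ultimately obtain y0 where y0: "y0 \<in> Y" "e \<le> infdist y0 A"
    "\<And>y. y \<in> Y \<Longrightarrow> e \<le> infdist y A \<Longrightarrow> infdist (f y0) B \<le> infdist (f y) B"
    using continuous_attains_inf[OF _ False cont] by blast
  have "f y0 \<notin> B" using assms(5,6) y0 by fastforce
  then have "infdist (f y0) B > 0"
    using assms(3,4) in_closed_iff_infdist_zero infdist_nonneg by (metis less_eq_real_def)
  then show thesis using that[of "infdist (f y0) B"] y0(3) by force
qed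

lemma compact_subcontinua:
  "compact X \<Longrightarrow> A \<in> subcontinua X \<Longrightarrow> compact A \<and> A \<noteq> {} \<and> A \<subseteq> X \<and> connected A"
  by (auto simp: subcontinua_def closedin_compact dest: closedin_imp_subset)

lemma subcontinua_compactI:
  fixes X :: "'a::metric_space set"
  shows "compact A \<Longrightarrow> A \<noteq> {} \<Longrightarrow> A \<subseteq> X \<Longrightarrow> connected A \<Longrightarrow> A \<in> subcontinua X"
  by (auto simp: subcontinua_def intro: closed_subset compact_imp_closed)

lemma hausdorff_dist_infdist_less:
  assumes "hausdorff_dist A B < d" "a \<in> A" "compact A" "compact B" "B \<noteq> {}"
  shows "infdist a B < d"
  using assms infdist_le_hausdorff_dist[of a A B] by (force simp: compact_imp_bounded)

lemma infdist_less_witness: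
  assumes "infdist x A < d" "A \<noteq> {}"
  obtains a where "a \<in> A" "dist x a < d"
  using assms by (auto simp: infdist_notempty cINF_less_iff)

lemma continuous_map_image_hyperspace:
  fixes f :: "'a::metric_space \<Rightarrow> 'b::metric_space"
  assumes "continuum Y" "continuous_on Y f" "continuum X" "f ` Y \<subseteq> X"
  shows "continuous_map (subcontinua_at_top q Y) (subcontinua_at_top (f q) X) ((`) f)"
proof -
  have cY: "compact Y" using assms(1) by (simp add: continuum_def)
  have "f ` A \<in> subcontinua_at (f q) X" if "A \<in> subcontinua_at q Y" for A
  proof -
    have A: "compact A" "A \<noteq> {}" "A \<subseteq> Y" "connected A" "q \<in> A"
      using that compact_subcontinua[OF cY] by (auto simp: subcontinua_at_def)
    then have "continuous_on A f" using assms(2) continuous_on_subset by blast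
    then show ?thesis using A assms(4)
      by (auto simp: subcontinua_at_def intro!: subcontinua_compactI compact_continuous_image
          connected_continuous_image)
  qed
  moreover have "\<exists>d>0. \<forall>A'. A' \<in> subcontinua_at q Y \<and> hausdorff_dist A A' < d \<longrightarrow>
      hausdorff_dist (f ` A) (f ` A') < e"
    if "A \<in> subcontinua_at q Y" "e > 0" for A e
  proof -
    have "uniformly_continuous_on Y f"
      using cY assms(2) compact_uniformly_continuous by blast
    \<comment> \<open>Half of \<open>e\<close> leaves room: a supremum of distances below a bound
      may reach the bound.\<close>
    then obtain d where d: "d > 0" "\<And>x y. x \<in> Y \<Longrightarrow> y \<in> Y \<Longrightarrow> dist x y < d \<Longrightarrow> dist (f x) (f y) < e/2"
      using \<open>e > 0\<close> unfolding uniformly_continuous_on_def by (metis half_gt_zero)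
    have le: "infdist (f a) (f ` B) \<le> e / 2"
      if h: "hausdorff_dist A B < d" "a \<in> A" "compact A" "compact B" "B \<noteq> {}" "A \<subseteq> Y" "B \<subseteq> Y"
      for A B a
    proof -
      obtain b where b: "b \<in> B" "dist a b < d"
        using infdist_less_witness[OF hausdorff_dist_infdist_less[OF h(1-5)]] h(5) by blast
      then have "dist (f a) (f b) < e / 2" using h d by auto
      then show ?thesis using infdist_le[of "f b" "f ` B" "f a"] b by auto
    qed
    show ?thesis
    proof (intro exI conjI allI impI)
      fix A' assume A': "A' \<in> subcontinua_at q Y \<and> hausdorff_dist A A' < d"
      have A: "compact A" "A \<noteq> {}" "A \<subseteq> Y" "compact A'" "A' \<noteq> {}" "A' \<subseteq> Y"
        using that A' compact_subcontinua[OF cY] by (auto simp: subcontinua_at_def)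
      then have "compact (f ` A)" "compact (f ` A')"
        using assms(2) continuous_on_subset compact_continuous_image by metis+
      then have "hausdorff_dist (f ` A) (f ` A') \<le> e / 2"
        using A A' le[of A A'] le[of A' A]
        by (intro hausdorff_dist_le) (auto simp: compact_imp_bounded hausdorff_dist_commute)
      then show "hausdorff_dist (f ` A) (f ` A') < e" using \<open>e > 0\<close> by simp
    qed (rule d)
  qed
  ultimately show ?thesis
    unfolding subcontinua_at_top_def
    by (subst Metric_space.metric_continuous_map)
       (auto intro!: Metric_space_subcontinua_at assms)
qed

text \<open>Compactness of \<open>Y\<close> makes \<open>f\<close> a closed map, and connected sets
  have connected preimages under closed maps with connected fibres.\<close>

lemma connected_preimage_compact:
  fixes f :: "'a::metric_space \<Rightarrow> 'b::metric_space"
  assumes "compact Y" "continuous_on Y f" "f ` Y = X"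
    and "\<And>x. x \<in> X \<Longrightarrow> connected (Y \<inter> f -` {x})"
    and "connected B" "B \<subseteq> X"
  shows "connected (Y \<inter> f -` B)"
proof (rule connected_closed_monotone_preimage[OF assms(2,3) _ assms(4-6)])
  fix C assume "closedin (top_of_set Y) C"
  then have "compact C" "C \<subseteq> Y"
    using assms(1) closedin_compact closedin_imp_subset by blast+
  then have "compact (f ` C)"
    using assms(2) continuous_on_subset compact_continuous_image by metis
  then show "closedin (top_of_set X) (f ` C)"
    using \<open>C \<subseteq> Y\<close> assms(3) by (auto intro!: closed_subset compact_imp_closed)
qed

text \<open>The density assumption says that the preimage of \<open>B\<close> is the closure of the one-point fibres in
  it.  It makes \<open>f\<close> injective on hyperspaces, because a subcontinuum contains all one-point fibres
  over its image, and it makes the inverse lower semicontinuous, because \<open>f\<close> is open at one-point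
  fibres.\<close>
lemma homeomorphic_hyperspaces:
  fixes f :: "'a::metric_space \<Rightarrow> 'b::metric_space"
  assumes X: "continuum X" and Y: "continuum Y" and f: "continuous_on Y f" "f ` Y = X"
    and fib: "\<And>x. x \<in> X \<Longrightarrow> connected (Y \<inter> f -` {x})"
    and q: "q \<in> Y"
    and dense: "\<And>B. B \<in> subcontinua_at (f q) X \<Longrightarrow>
      Y \<inter> f -` B \<subseteq> closure {y \<in> Y. f y \<in> B \<and> Y \<inter> f -` {f y} = {y}}"
  shows "subcontinua_at_top q Y homeomorphic_space subcontinua_at_top (f q) X"
proof -
  have cY: "compact Y" and cX: "compact X" using X Y by (auto simp: continuum_def)
  interpret MX: Metric_space "subcontinua_at (f q) X" hausdorff_dist
    by (rule Metric_space_subcontinua_at[OF X])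
  interpret MY: Metric_space "subcontinua_at q Y" hausdorff_dist
    by (rule Metric_space_subcontinua_at[OF Y])
  define g where "g = (\<lambda>B. Y \<inter> f -` B)"
  have B: "compact B \<and> B \<noteq> {} \<and> B \<subseteq> X \<and> connected B \<and> f q \<in> B"
    if "B \<in> subcontinua_at (f q) X" for B
    using that compact_subcontinua[OF cX] by (auto simp: subcontinua_at_def)
  have A: "compact A \<and> A \<noteq> {} \<and> A \<subseteq> Y \<and> connected A \<and> q \<in> A"
    if "A \<in> subcontinua_at q Y" for A
    using that compact_subcontinua[OF cY] by (auto simp: subcontinua_at_def)
  have fgB: "f ` g B = B" if "B \<in> subcontinua_at (f q) X" for B
    using B[OF that] f(2) by (auto simp: g_def)
  have gB: "g B \<in> subcontinua_at q Y" if "B \<in> subcontinua_at (f q) X" for B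
  proof -
    have "connected (g B)"
      unfolding g_def
      by (rule connected_preimage_compact[OF cY f fib]) (use B[OF that] in auto)
    moreover have "closedin (top_of_set Y) (g B)"
      unfolding g_def using B[OF that]
      by (intro continuous_closedin_preimage f compact_imp_closed) auto
    moreover have "q \<in> g B" using B[OF that] q by (auto simp: g_def)
    ultimately show ?thesis by (auto simp: subcontinua_at_def subcontinua_def)
  qed
  have fcont: "continuous_map MY.mtopology MX.mtopology ((`) f)"
    using continuous_map_image_hyperspace[OF Y f(1) X] f(2)
    by (simp add: subcontinua_at_top_def)
  have fA: "f ` A \<in> subcontinua_at (f q) X" if "A \<in> subcontinua_at q Y" for A
    using continuous_map_funspace[OF fcont] that by auto
  have gfA: "g (f ` A) = A" if "A \<in> subcontinua_at q Y" for A
  proof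
    have "{y \<in> Y. f y \<in> f ` A \<and> Y \<inter> f -` {f y} = {y}} \<subseteq> A"
    proof
      fix y assume y: "y \<in> {y \<in> Y. f y \<in> f ` A \<and> Y \<inter> f -` {f y} = {y}}"
      then obtain a where "a \<in> A" "f a = f y" by auto
      then have "a \<in> Y \<inter> f -` {f y}" using A[OF that] by auto
      then show "y \<in> A" using y \<open>a \<in> A\<close> by auto
    qed
    then have "closure {y \<in> Y. f y \<in> f ` A \<and> Y \<inter> f -` {f y} = {y}} \<subseteq> A"
      using A[OF that] by (intro closure_minimal compact_imp_closed) auto
    then show "g (f ` A) \<subseteq> A"
      using dense[OF fA[OF that]] unfolding g_def by blast
    show "A \<subseteq> g (f ` A)" using A[OF that] by (auto simp: g_def)
  qed
  have "\<exists>d>0. \<forall>B'. B' \<in> subcontinua_at (f q) X \<and> hausdorff_dist B B' < d \<longrightarrow>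
      hausdorff_dist (g B) (g B') < e"
    if BX: "B \<in> subcontinua_at (f q) X" and e: "e > 0" for B e
  proof -
    \<comment> \<open>Upper semicontinuity: points of \<open>Y\<close> whose image is near
      \<open>B\<close>, among them all points of \<open>g B'\<close> for \<open>B'\<close> near
      \<open>B\<close>, are near \<open>g B\<close>.\<close>
    obtain d1 where d1: "d1 > 0" "\<And>y. y \<in> Y \<Longrightarrow> infdist (f y) B < d1 \<Longrightarrow> infdist y (g B) < e/2"
      by (rule preimage_near[OF cY f(1), of B "g B" "e/2"])
         (use B[OF BX] e in \<open>auto simp: g_def compact_imp_closed\<close>)
    define D where "D = {y \<in> Y. f y \<in> B \<and> Y \<inter> f -` {f y} = {y}}"
    \<comment> \<open>Lower semicontinuity: finitely many one-point fibres come within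
      \<open>e/4\<close> of all of \<open>g B\<close>, so that the radii \<open>\<delta>\<close>
      belonging to them have a positive minimum.\<close>
    have "g B \<subseteq> (\<Union>y\<in>D. ball y (e/4))"
    proof
      fix a assume "a \<in> g B"
      then have "a \<in> closure D" using dense[OF BX] by (auto simp: g_def D_def)
      then obtain y where "y \<in> D" "dist y a < e/4"
        using e by (auto simp: closure_approachable dest!: spec[of _ "e/4"])
      then show "a \<in> (\<Union>y\<in>D. ball y (e/4))" by auto
    qed
    then obtain F where F: "F \<subseteq> D" "finite F" "g B \<subseteq> (\<Union>y\<in>F. ball y (e/4))"
      using compactE_image[of "g B" D "\<lambda>y. ball y (e/4)"] A[OF gB[OF BX]] by auto
    have "\<exists>d>0. \<forall>z\<in>Y. dist (f z) (f y) < d \<longrightarrow> dist z y < e/4" if "y \<in> D" for y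
      by (rule preimage_near[OF cY f(1), of "{f y}" "{y}" "e/4"])
         (use that e in \<open>auto simp: D_def\<close>)
    then obtain \<delta> where \<delta>: "\<And>y. y \<in> D \<Longrightarrow> \<delta> y > 0"
        "\<And>y z. y \<in> D \<Longrightarrow> z \<in> Y \<Longrightarrow> dist (f z) (f y) < \<delta> y \<Longrightarrow> dist z y < e/4"
      by metis
    define d where "d = Min (insert d1 (\<delta> ` F))"
    have d: "d > 0" "d \<le> d1" "\<And>y. y \<in> F \<Longrightarrow> d \<le> \<delta> y"
      unfolding d_def using F \<delta>(1) d1(1) by (auto simp: subset_iff)
    have "hausdorff_dist (g B) (g B') < e"
      if B'X: "B' \<in> subcontinua_at (f q) X" and h: "hausdorff_dist B B' < d" for B'
    proof -
      note gg = A[OF gB[OF BX]] A[OF gB[OF B'X]] and BB = B[OF BX] B[OF B'X]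
      have "hausdorff_dist (g B) (g B') \<le> e/2"
      proof (rule hausdorff_dist_le)
        fix a assume "a \<in> g B"
        then obtain y where y: "y \<in> F" "dist y a < e/4" using F(3) by auto
        then have yD: "y \<in> D" using F(1) by auto
        then have "f y \<in> B" by (auto simp: D_def)
        then have "infdist (f y) B' < d"
          using hausdorff_dist_infdist_less h BB by blast
        then obtain b where b: "b \<in> B'" "dist (f y) b < d"
          using infdist_less_witness BB by blast
        \<comment> \<open>As the fibre of \<open>y\<close> is a single point, any preimage of a
          point near \<open>f y\<close> is near \<open>y\<close>.\<close>
        then obtain z where z: "z \<in> Y" "f z = b" using BB f(2) by blast
        then have "dist z y < e/4"
          using \<delta>(2)[OF yD z(1)] b d(3)[OF y(1)] by (simp add: dist_commute)
        then have "dist a z < e/2"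
          using y(2) dist_triangle2[of a z y] by (simp add: dist_commute)
        moreover have "z \<in> g B'" using z b by (auto simp: g_def)
        ultimately show "infdist a (g B') \<le> e/2" using infdist_le[of z "g B'" a] by linarith
      next
        fix a assume "a \<in> g B'"
        then have "a \<in> Y" "f a \<in> B'" by (auto simp: g_def)
        moreover have "infdist (f a) B < d"
          using hausdorff_dist_infdist_less[of B' B d "f a"] \<open>f a \<in> B'\<close> h BB
          by (auto simp: hausdorff_dist_commute)
        ultimately show "infdist a (g B) \<le> e/2" using d1(2)[of a] d(2) by auto
      qed (use gg in \<open>auto simp: compact_imp_bounded\<close>)
      then show ?thesis using e by linarith
    qed
    then show ?thesis using d(1) by blast
  qed
  then have gcont: "continuous_map MX.mtopology MY.mtopology g"
    using gB by (subst MX.metric_continuous_map[OF MY.Metric_space_axioms]) auto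
  show ?thesis
    unfolding homeomorphic_space_def homeomorphic_maps_def subcontinua_at_top_def
    using fcont gcont fgB gfA by (intro exI[of _ "(`) f"] exI[of _ g]) auto
qed

subsection \<open>An indecomposable continuum\<close>

text \<open>By compactness \<open>f\<close> is a homeomorphism onto its image, so its inverse
  carries a decomposition back. This passes indecomposability on from \<open>knaster\<close> to its
  embedded copy.\<close>

lemma decomposable_image:
  fixes f :: "'a::metric_space \<Rightarrow> 'b::metric_space"
  assumes "compact C" "continuous_on C f" "inj_on f C" "decomposable (f ` C)"
  shows "decomposable C"
proof -
  obtain g where g: "homeomorphism C (f ` C) f g"
    using homeomorphism_compact[OF assms(1,2) refl assms(3)] by auto
  obtain A B where AB: "A \<in> subcontinua (f ` C)" "B \<in> subcontinua (f ` C)" "A \<noteq> f ` C" "B \<noteq> f ` C"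
      "f ` C = A \<union> B"
    using assms(4) unfolding decomposable_def by blast
  have fgA: "f ` g ` A = A" if "A \<subseteq> f ` C" for A
    using that g by (force simp: homeomorphism_def image_image)
  have *: "g ` A \<in> subcontinua C - {C}" if "A \<in> subcontinua (f ` C)" "A \<noteq> f ` C" for A
  proof -
    have A: "compact A" "A \<noteq> {}" "A \<subseteq> f ` C" "connected A"
      using compact_subcontinua[OF compact_continuous_image[OF assms(2,1)] that(1)] by auto
    have "continuous_on A g"
      using g A(3) continuous_on_subset by (auto simp: homeomorphism_def)
    moreover have "g ` A \<subseteq> C" using g A(3) by (auto simp: homeomorphism_def)
    ultimately have "g ` A \<in> subcontinua C"
      using A by (intro subcontinua_compactI compact_continuous_image connected_continuous_image) auto
    then show ?thesis using that(2) fgA[OF A(3)] by auto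
  qed
  have "C = g ` (f ` C)" using g by (force simp: homeomorphism_def image_image)
  then have "C = g ` A \<union> g ` B" unfolding AB(5) image_Un .
  then show ?thesis
    unfolding decomposable_def by (intro bexI) (use * AB in simp_all)
qed


text \<open>The inverse limit of the map \<open>t \<mapsto> 2 * t\<^sup>2 - 1\<close> on \<open>[-1, 1]\<close>, which is Knaster's buckethandle
  continuum.  The formula \<open>cos (2 * t) = 2 * (cos t)\<^sup>2 - 1\<close> provides a dense ray.\<close>
definition knaster :: "(nat \<Rightarrow> real) set" where
  "knaster = {x. \<forall>n. x n \<in> {-1..1} \<and> x n = 2 * (x (Suc n))\<^sup>2 - 1}"

definition knaster_ray :: "real \<Rightarrow> nat \<Rightarrow> real" where
  "knaster_ray u = (\<lambda>n. cos (u / 2 ^ n))"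

lemma tendsto_coordinatewise:
  fixes f :: "'c \<Rightarrow> 'i \<Rightarrow> 'b::topological_space"
  assumes "\<And>i. ((\<lambda>c. f c i) \<longlongrightarrow> l i) F"
  shows "(f \<longlongrightarrow> l) F"
proof -
  have "limitin (product_topology (\<lambda>i. euclidean) UNIV) f l F"
    using assms by (subst limitin_componentwise) auto
  then show ?thesis by (simp add: euclidean_product_topology)
qed

lemma knaster_ray_in: "knaster_ray u \<in> knaster"
proof -
  have "cos (u / 2 ^ n) = 2 * (cos (u / 2 ^ Suc n))\<^sup>2 - 1" for n
    using cos_double_cos[of "u / 2 ^ Suc n"] by simp
  moreover have "cos (u / 2 ^ n) \<in> {-1..1}" for n by simp
  ultimately show ?thesis unfolding knaster_def knaster_ray_def by blast
qed

lemma knaster_range: "x \<in> knaster \<Longrightarrow> x n \<in> {-1..1}"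
  unfolding knaster_def by blast

lemma knaster_step: "x \<in> knaster \<Longrightarrow> x n = 2 * (x (Suc n))\<^sup>2 - 1"
  unfolding knaster_def by blast

lemma knaster_agree:
  assumes "x \<in> knaster" "y \<in> knaster" "x n = y n" "k \<le> n"
  shows "x k = y k"
  using assms(4)
proof (induction rule: inc_induct)
  case base
  show ?case by (rule assms(3))
next
  case (step k)
  have "x k = 2 * (x (Suc k))\<^sup>2 - 1" "y k = 2 * (y (Suc k))\<^sup>2 - 1"
    using assms(1,2) knaster_step by blast+
  then show ?case using step.IH by simp
qed

lemma knaster_ray_arccos: "t \<in> {-1..1} \<Longrightarrow> knaster_ray (2 ^ n * arccos t) n = t"
  by (simp add: knaster_ray_def)

text \<open>A coordinate of a point of \<open>knaster\<close> determines all earlier ones, so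
  agreement at some \<open>m \<ge> n\<close> is agreement up to \<open>n\<close>, and each fixed
  coordinate of \<open>y n\<close> is eventually that of \<open>x\<close>.\<close>

lemma tendsto_knaster:
  assumes "x \<in> knaster" "\<And>n. y n \<in> knaster" "\<And>n. \<exists>m\<ge>n. y n m = x m"
  shows "y \<longlonglongrightarrow> x"
proof (rule tendsto_coordinatewise)
  fix k
  have "y n k = x k" if "n \<ge> k" for n
    using assms knaster_agree that order_trans by metis
  then show "(\<lambda>n. y n k) \<longlonglongrightarrow> x k"
    by (intro tendsto_eventually) (auto simp: eventually_sequentially)
qed

text \<open>The ray point with parameter \<open>2 ^ n * arccos (x n)\<close> shares coordinate
  \<open>n\<close> with \<open>x\<close>. These parameters are nonnegative, as the blow-up will
  require.\<close>

lemma tendsto_knaster_ray: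
  assumes "x \<in> knaster"
  shows "(\<lambda>n. knaster_ray (2 ^ n * arccos (x n))) \<longlonglongrightarrow> x"
proof (rule tendsto_knaster[OF assms knaster_ray_in])
  show "\<exists>m\<ge>n. knaster_ray (2 ^ n * arccos (x n)) m = x m" for n
    using knaster_ray_arccos[OF knaster_range[OF assms]] by blast
qed

lemma compact_knaster: "compact knaster"
proof -
  have "compactin (product_topology (\<lambda>i. euclidean) UNIV) (PiE UNIV (\<lambda>_::nat. {-1..1::real}))"
    by (subst compactin_PiE) auto
  then have "compact (PiE UNIV (\<lambda>_::nat. {-1..1::real}))"
    by (simp add: euclidean_product_topology)
  moreover have "closed {x :: nat \<Rightarrow> real. \<forall>n. x n = 2 * (x (Suc n))\<^sup>2 - 1}"
    by (intro closed_Collect_all closed_Collect_eq continuous_intros continuous_on_product_coordinates)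
  ultimately have "compact (PiE UNIV (\<lambda>_::nat. {-1..1::real}) \<inter> {x. \<forall>n. x n = 2 * (x (Suc n))\<^sup>2 - 1})"
    by (rule compact_Int_closed)
  also have "PiE UNIV (\<lambda>_::nat. {-1..1}) \<inter> {x. \<forall>n. x n = 2 * (x (Suc n))\<^sup>2 - 1} = knaster"
    by (auto simp: knaster_def PiE_def Pi_def)
  finally show ?thesis .
qed

lemma continuous_on_knaster_ray: "continuous_on S knaster_ray"
  unfolding knaster_ray_def by (intro continuous_intros) auto

text \<open>The set is the closure of the ray, a continuous image of the line.\<close>

lemma connected_knaster: "connected knaster"
proof -
  have "closure (range knaster_ray) = knaster"
  proof
    show "closure (range knaster_ray) \<subseteq> knaster"
      using knaster_ray_in compact_knaster by (intro closure_minimal compact_imp_closed) auto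
    show "knaster \<subseteq> closure (range knaster_ray)"
    proof
      fix x assume "x \<in> knaster"
      then show "x \<in> closure (range knaster_ray)"
        unfolding closure_sequential using tendsto_knaster_ray
        by (intro exI[of _ "\<lambda>n. knaster_ray (2 ^ n * arccos (x n))"]) auto
    qed
  qed
  then show ?thesis
    using connected_imp_connected_closure[OF
        connected_continuous_image[OF continuous_on_knaster_ray connected_UNIV]]
    by simp
qed

text \<open>If arbitrarily late coordinates mapped \<open>A\<close> onto \<open>[-1, 1]\<close>,
  every point of \<open>knaster\<close> would be a limit of points of \<open>A\<close> agreeing with
  it in ever later coordinates.\<close>

lemma knaster_proper_closed:
  assumes "closed A" "A \<subseteq> knaster" "A \<noteq> knaster"
  obtains n where "\<And>m. m \<ge> n \<Longrightarrow> \<not> {-1..1} \<subseteq> (\<lambda>x. x m) ` A"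
proof (rule ccontr)
  assume "\<not> thesis"
  then have full: "\<exists>m\<ge>n. {-1..1} \<subseteq> (\<lambda>x. x m) ` A" for n
    using that by blast
  have "x \<in> A" if "x \<in> knaster" for x
  proof -
    have "\<exists>a\<in>A. \<exists>m\<ge>n. a m = x m" for n
    proof -
      obtain m where m: "m \<ge> n" "{-1..1} \<subseteq> (\<lambda>x. x m) ` A" using full by blast
      moreover have "x m \<in> {-1..1}" using that by (rule knaster_range)
      ultimately obtain a where "a \<in> A" "a m = x m" by (metis (no_types, lifting) imageE subsetD)
      then show ?thesis using m(1) by blast
    qed
    then obtain a where a: "\<And>n. a n \<in> A" "\<And>n. \<exists>m\<ge>n. a n m = x m" by metis
    then have "a \<longlonglongrightarrow> x" using assms(2) that by (intro tendsto_knaster) auto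
    then show ?thesis using assms(1) a(1) closed_sequentially by blast
  qed
  then show False using assms by blast
qed

text \<open>The map \<open>t \<mapsto> 2 * t\<^sup>2 - 1\<close> folds each half of \<open>[-1, 1]\<close> onto the whole interval.\<close>
lemma knaster_connected_full:
  assumes "connected S" "S \<subseteq> knaster" "x \<in> S" "x (Suc n) = 0" "y \<in> S" "\<bar>y (Suc n)\<bar> = 1"
  shows "{-1..1} \<subseteq> (\<lambda>x. x n) ` S"
proof
  fix t :: real assume t: "t \<in> {-1..1}"
  define c where "c = y (Suc n)"
  \<comment> \<open>\<open>s\<close> solves \<open>2 * s\<^sup>2 - 1 = t\<close> between
    \<open>0\<close> and \<open>c\<close>, a half interval that the connected projection covers. As
    \<open>c\<close> may be \<open>-1\<close>, both orders of the end points occur.\<close>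
  define s where "s = c * sqrt ((t + 1) / 2)"
  have conn: "connected ((\<lambda>x. x (Suc n)) ` S)"
    by (intro connected_continuous_image assms(1)
        continuous_on_subset[OF continuous_on_product_coordinates]) auto
  have mem: "0 \<in> (\<lambda>x. x (Suc n)) ` S" "c \<in> (\<lambda>x. x (Suc n)) ` S"
    using assms by (auto simp: c_def image_iff intro: bexI[of _ x])
  have r: "0 \<le> sqrt ((t + 1) / 2)" "sqrt ((t + 1) / 2) \<le> 1" using t by auto
  have c: "c = 1 \<or> c = -1" using assms(6) by (auto simp: c_def)
  then have "s \<in> {0..c} \<or> s \<in> {c..0}" using r by (auto simp: s_def)
  then have "s \<in> (\<lambda>x. x (Suc n)) ` S"
    using connected_contains_Icc[OF conn mem] connected_contains_Icc[OF conn mem(2,1)] by blast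
  then obtain z where z: "z \<in> S" "z (Suc n) = s" by auto
  then have "z n = 2 * s\<^sup>2 - 1" using assms(2) knaster_step[of z n] by auto
  also have "s\<^sup>2 = (t + 1) / 2" using c t by (auto simp: s_def power_mult_distrib)
  finally have "z n = t" by (simp add: field_simps)
  then show "t \<in> (\<lambda>x. x n) ` S" using z by auto
qed

text \<open>At a late coordinate \<open>n\<close> neither part projects onto \<open>[-1, 1]\<close>,
  so by folding no part has points with both \<open>0\<close> and \<open>1\<close>, or both
  \<open>0\<close> and \<open>-1\<close>, at coordinate \<open>Suc n\<close>. Hence points with
  \<open>1\<close> and \<open>-1\<close> there share a part, and connectedness gives this part a
  point with \<open>0\<close> as well.\<close>

lemma knaster_indecomposable: "\<not> decomposable knaster"
proof
  assume "decomposable knaster"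
  then obtain A B where AB: "A \<in> subcontinua knaster" "B \<in> subcontinua knaster"
      "A \<noteq> knaster" "B \<noteq> knaster" "knaster = A \<union> B"
    unfolding decomposable_def by blast
  note A = compact_subcontinua[OF compact_knaster AB(1)]
    and B = compact_subcontinua[OF compact_knaster AB(2)]
  obtain n1 where n1: "\<And>m. m \<ge> n1 \<Longrightarrow> \<not> {-1..1} \<subseteq> (\<lambda>x. x m) ` A"
    using knaster_proper_closed[of A] A AB(3) compact_imp_closed by metis
  obtain n2 where n2: "\<And>m. m \<ge> n2 \<Longrightarrow> \<not> {-1..1} \<subseteq> (\<lambda>x. x m) ` B"
    using knaster_proper_closed[of B] B AB(4) compact_imp_closed by metis
  define n where "n = max n1 n2"
  have "\<not> (x (Suc n) = 0 \<and> \<bar>y (Suc n)\<bar> = 1)"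
    if "x \<in> A \<and> y \<in> A \<or> x \<in> B \<and> y \<in> B" for x y
    using knaster_connected_full[of A x n y] knaster_connected_full[of B x n y]
      n1[of n] n2[of n] A B that by (auto simp: n_def)
  note * = this
  define w where "w = (\<lambda>t. knaster_ray (2 ^ Suc n * arccos t))"
  have w: "w t (Suc n) = t" if "t \<in> {-1..1}" for t
    unfolding w_def using knaster_ray_arccos[OF that] .
  have "w t \<in> A \<or> w t \<in> B" for t using AB(5) knaster_ray_in unfolding w_def by blast
  then have C: "(w 0 \<in> A \<and> w 1 \<in> B \<and> w (-1) \<in> B) \<or> (w 0 \<in> B \<and> w 1 \<in> A \<and> w (-1) \<in> A)"
    using *[of "w 0" "w 1"] *[of "w 0" "w (-1)"] w[of 0] w[of 1] w[of "-1"] by force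
  have zero: "\<exists>x\<in>S. x (Suc n) = 0" if "connected S" "w 1 \<in> S" "w (-1) \<in> S" for S
  proof -
    have "connected ((\<lambda>x. x (Suc n)) ` S)"
      by (intro connected_continuous_image that(1)
          continuous_on_subset[OF continuous_on_product_coordinates]) auto
    moreover have "-1 \<in> (\<lambda>x. x (Suc n)) ` S" "1 \<in> (\<lambda>x. x (Suc n)) ` S"
      using imageI[OF that(2), of "\<lambda>x. x (Suc n)"] imageI[OF that(3), of "\<lambda>x. x (Suc n)"]
        w[of 1] w[of "-1"] by simp_all
    ultimately have "{-1..1} \<subseteq> (\<lambda>x. x (Suc n)) ` S" by (rule connected_contains_Icc)
    then have "0 \<in> (\<lambda>x. x (Suc n)) ` S" by auto
    then show ?thesis by auto
  qed
  show False
    using C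
  proof
    assume h: "w 0 \<in> A \<and> w 1 \<in> B \<and> w (-1) \<in> B"
    then obtain x where "x \<in> B" "x (Suc n) = 0" using zero[of B] B by blast
    then show False using *[of x "w 1"] h w[of 1] by auto
  next
    assume h: "w 0 \<in> B \<and> w 1 \<in> A \<and> w (-1) \<in> A"
    then obtain x where "x \<in> A" "x (Suc n) = 0" using zero[of A] A by blast
    then show False using *[of x "w 1"] h w[of 1] by auto
  qed
qed

text \<open>The constant sequences at the two fixed points of the folding map; they witness that
  \<open>knaster\<close> is nondegenerate.\<close>

lemma knaster_two_points: "(\<lambda>_. 1) \<in> knaster" "(\<lambda>_. - 1 / 2) \<in> knaster"
  by (auto simp: knaster_def power2_eq_square)

subsection \<open>Blowing up a point\<close>

text \<open>Intermediate values between a large multiple \<open>a\<close> of \<open>2 * pi\<close>,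
  where the product vanishes, and \<open>a + pi / 2\<close>, where it is at least
  \<open>u\<close>.\<close>

lemma mult_sin_attains:
  fixes u c :: real
  assumes "0 \<le> u"
  obtains s where "c \<le> s" "s > 0" "s * sin s = u"
proof -
  obtain k :: nat where k: "max (max c u) 1 < real k" using reals_Archimedean2 by blast
  define a where "a = 2 * pi * real k"
  have "real k * 1 \<le> real k * (2 * pi)" using pi_gt3 by (intro mult_left_mono) auto
  then have "real k \<le> a" by (simp add: a_def mult.commute)
  then have a: "c \<le> a" "u \<le> a" "0 < a" using k by auto
  have "sin a = 0" "sin (a + pi / 2) = 1"
    using sin_2npi[of k] cos_2npi[of k] by (simp_all add: a_def sin_add mult_ac)
  moreover have "continuous_on {a..a + pi / 2} (\<lambda>s. s * sin s)"
    by (intro continuous_intros)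
  ultimately obtain s where "a \<le> s" "s * sin s = u"
    using IVT'[of "\<lambda>s. s * sin s" a u "a + pi / 2"] a assms pi_gt_zero by auto
  then show thesis using that[of s] a by linarith
qed

text \<open>With \<open>s = 1 / dist x m\<close>, the parameter \<open>s * sin s\<close> of the ray takes every nonnegative value for
  arbitrarily large \<open>s\<close>.  The value at \<open>x = m\<close>, where the division yields \<open>0\<close>, is irrelevant.\<close>
definition blowup_map :: "'a::metric_space \<Rightarrow> 'a \<Rightarrow> nat \<Rightarrow> real" where
  "blowup_map m x = knaster_ray (1 / dist x m * sin (1 / dist x m))"

definition blowup :: "'a::metric_space set \<Rightarrow> 'a \<Rightarrow> ('a \<times> (nat \<Rightarrow> real)) set" where
  "blowup X m = {z \<in> X \<times> knaster. fst z = m \<or> snd z = blowup_map m (fst z)}"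

lemma blowup_map_in: "blowup_map m x \<in> knaster"
  unfolding blowup_map_def by (rule knaster_ray_in)

lemma blowup_fibre: "x \<in> X \<Longrightarrow> x \<noteq> m \<Longrightarrow> blowup X m \<inter> fst -` {x} = {(x, blowup_map m x)}"
  using blowup_map_in[of m] by (auto simp: blowup_def)

lemma blowup_fibre_centre: "m \<in> X \<Longrightarrow> blowup X m \<inter> fst -` {m} = Pair m ` knaster"
  by (auto simp: blowup_def)

lemma fst_blowup: "fst ` blowup X m = X"
  using blowup_map_in[of m] by (force simp: blowup_def)

text \<open>The set is closed in a compact product: near a limit over a point other than
  \<open>m\<close> only the graph matters, and \<open>blowup_map m\<close> is continuous there; over
  \<open>m\<close> all of \<open>knaster\<close> is allowed.\<close>

lemma compact_blowup:
  assumes "compact X"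
  shows "compact (blowup X m)"
proof -
  have XK: "compact (X \<times> knaster)" using assms compact_knaster by (rule compact_Times)
  have cont: "isCont (blowup_map m) x" if "x \<noteq> m" for x
  proof -
    have "continuous_on {x. x \<noteq> m} (blowup_map m)"
      unfolding blowup_map_def
      by (intro continuous_intros continuous_on_compose2[OF continuous_on_knaster_ray[of UNIV]]) auto
    moreover have "open {x. x \<noteq> m}" by (intro open_Collect_neq continuous_intros)
    ultimately show ?thesis using that by (simp add: continuous_on_eq_continuous_at)
  qed
  have "closed (blowup X m)"
    unfolding closed_sequential_limits
  proof (intro allI impI)
    fix z l assume h: "(\<forall>n. z n \<in> blowup X m) \<and> z \<longlonglongrightarrow> l"
    then have zl: "z \<longlonglongrightarrow> l" by blast
    have "l \<in> X \<times> knaster"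
      using h closed_sequentially[OF compact_imp_closed[OF XK], of z l] by (auto simp: blowup_def)
    moreover have "snd l = blowup_map m (fst l)" if ne: "fst l \<noteq> m"
    proof -
      have "eventually (\<lambda>n. fst (z n) \<noteq> m) sequentially"
        by (rule tendsto_imp_eventually_ne[OF tendsto_fst[OF zl] ne])
      then have "eventually (\<lambda>n. blowup_map m (fst (z n)) = snd (z n)) sequentially"
        by eventually_elim (use h in \<open>auto simp: blowup_def\<close>)
      moreover have "(\<lambda>n. blowup_map m (fst (z n))) \<longlonglongrightarrow> blowup_map m (fst l)"
        by (rule isCont_tendsto_compose[OF cont[OF ne] tendsto_fst[OF zl]])
      ultimately have "(\<lambda>n. snd (z n)) \<longlonglongrightarrow> blowup_map m (fst l)"
        by (rule Lim_transform_eventually[rotated])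
      then show ?thesis using tendsto_snd[OF zl] LIMSEQ_unique by blast
    qed
    ultimately show "l \<in> blowup X m" by (auto simp: blowup_def)
  qed
  then have "compact (X \<times> knaster \<inter> blowup X m)" using XK by (rule compact_Int_closed[rotated])
  moreover have "X \<times> knaster \<inter> blowup X m = blowup X m" by (auto simp: blowup_def)
  ultimately show ?thesis by simp
qed

lemma connected_blowup_fibre:
  assumes "m \<in> X" "x \<in> X"
  shows "connected (blowup X m \<inter> fst -` {x})"
proof (cases "x = m")
  case True
  then show ?thesis
    using blowup_fibre_centre[OF assms(1)]
    by (auto intro!: connected_continuous_image connected_knaster continuous_intros)
next
  case False
  then show ?thesis using blowup_fibre[OF assms(2)] by simp
qed

lemma continuum_blowup:
  assumes "continuum X" "m \<in> X"
  shows "continuum (blowup X m)"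
proof -
  have "connected (blowup X m \<inter> fst -` X)"
    by (rule connected_preimage_compact[OF _ _ fst_blowup connected_blowup_fibre])
       (use assms in \<open>auto simp: continuum_def compact_blowup intro!: continuous_intros\<close>)
  moreover have "blowup X m \<inter> fst -` X = blowup X m" by (auto simp: blowup_def)
  ultimately show ?thesis
    using assms compact_blowup[of X m] fst_blowup[of X m] by (auto simp: continuum_def)
qed

text \<open>Points not over \<open>m\<close> form one-point fibres themselves. For a point
  \<open>(m, l)\<close>, the connected set \<open>B\<close> contains \<open>p\<close> besides
  \<open>m\<close>, hence has points at every small distance from \<open>m\<close>, and the
  oscillation lets the graph over suitable ones approach \<open>l\<close>.\<close>

lemma blowup_preimage_dense:
  assumes "m \<in> X" "connected B" "B \<subseteq> X" "p \<in> B" "p \<noteq> m"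
  shows "blowup X m \<inter> fst -` B \<subseteq>
    closure {y \<in> blowup X m. fst y \<in> B \<and> blowup X m \<inter> fst -` {fst y} = {y}}" (is "_ \<subseteq> closure ?D")
proof
  have D: "(x, blowup_map m x) \<in> ?D" if "x \<in> B" "x \<noteq> m" for x
    using that assms(3) blowup_fibre[of x X m] blowup_map_in[of m x] by (auto simp: blowup_def)
  fix y assume y: "y \<in> blowup X m \<inter> fst -` B"
  show "y \<in> closure ?D"
  proof (cases "fst y = m")
    case False
    then have "y = (fst y, blowup_map m (fst y))" using y by (auto simp: blowup_def prod_eq_iff)
    then show ?thesis using D[of "fst y"] False y closure_subset by (metis (no_types, lifting) IntD2 subsetD vimageE)
  next
    case True
    then obtain l where l: "y = (m, l)" "l \<in> knaster" using y by (auto simp: blowup_def)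
    have mB: "m \<in> B" using y True by auto
    define r where "r = dist p m"
    have r: "r > 0" using assms(5) by (simp add: r_def)
    have "connected ((\<lambda>x. dist x m) ` B)"
      by (intro connected_continuous_image assms continuous_intros)
    moreover have "0 \<in> (\<lambda>x. dist x m) ` B" using mB by (auto intro!: image_eqI[of _ _ m])
    moreover have "r \<in> (\<lambda>x. dist x m) ` B" using assms(4) by (auto simp: r_def)
    ultimately have I: "{0..r} \<subseteq> (\<lambda>x. dist x m) ` B" by (rule connected_contains_Icc)
    define u where "u = (\<lambda>n. 2 ^ n * arccos (l n))"
    have "\<exists>x\<in>B. x \<noteq> m \<and> dist x m \<le> 1 / real (Suc n) \<and> blowup_map m x = knaster_ray (u n)" for n
    proof -
      have "l n \<in> {-1..1}" using l(2) by (rule knaster_range)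
      then have "0 \<le> u n" by (auto simp: u_def intro!: mult_nonneg_nonneg arccos_lbound)
      \<comment> \<open>The bound \<open>1 / r\<close> makes \<open>1 / s\<close> a distance
        attained on \<open>B\<close>; the bound \<open>Suc n\<close> drives the chosen points to
        \<open>m\<close>.\<close>
      then obtain s where s: "max (1 / r) (real (Suc n)) \<le> s" "s > 0" "s * sin s = u n"
        by (rule mult_sin_attains)
      then have "1 / s \<le> r" using r by (simp add: field_simps)
      then have "1 / s \<in> (\<lambda>x. dist x m) ` B" using I s(2) by (intro subsetD[OF I]) simp
      then obtain x where x: "x \<in> B" "dist x m = 1 / s" by auto
      moreover have "1 / s \<le> 1 / real (Suc n)" using s by (intro divide_left_mono) auto
      moreover have "x \<noteq> m" using x s(2) by auto
      moreover have "blowup_map m x = knaster_ray (u n)"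
        using s(3) by (simp add: blowup_map_def x(2))
      ultimately show ?thesis by (intro bexI[of _ x]) auto
    qed
    then obtain x where x: "\<And>n. x n \<in> B" "\<And>n. x n \<noteq> m" "\<And>n. dist (x n) m \<le> 1 / real (Suc n)"
        "\<And>n. blowup_map m (x n) = knaster_ray (u n)"
      by metis
    have "(\<lambda>n. dist (x n) m) \<longlonglongrightarrow> 0"
      by (rule tendsto_sandwich[OF _ _ tendsto_const LIMSEQ_inverse_real_of_nat])
         (use x(3) in \<open>auto simp: inverse_eq_divide\<close>)
    then have "x \<longlonglongrightarrow> m" by (subst tendsto_dist_iff)
    moreover have "(\<lambda>n. blowup_map m (x n)) \<longlonglongrightarrow> l"
      unfolding x(4) u_def by (rule tendsto_knaster_ray[OF l(2)])
    ultimately have "(\<lambda>n. (x n, blowup_map m (x n))) \<longlonglongrightarrow> y"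
      unfolding l(1) by (rule tendsto_Pair)
    then show ?thesis
      unfolding closure_sequential using D[OF x(1,2)]
      by (intro exI[of _ "\<lambda>n. (x n, blowup_map m (x n))"] conjI allI)
  qed
qed

theorem theorem4p2:
  fixes X :: "'a::metric_space set" and p :: 'a
  assumes "continuum X"
    and "hereditarily_decomposable X"
    and "\<exists>A. free_arc X A"
    and "p \<in> X"
  shows "\<exists>(Y :: (nat \<Rightarrow> real) set) q.
           continuum Y \<and> \<not> hereditarily_decomposable Y \<and> q \<in> Y \<and>
           subcontinua_at_top p X homeomorphic_space subcontinua_at_top q Y"
proof -
  obtain m where m: "m \<in> X" "m \<noteq> p"
  proof -
    \<comment> \<open>The end points of the free arc are two points of \<open>X\<close>, so one of
      them differs from \<open>p\<close>.\<close>
    obtain A and g :: "real \<Rightarrow> 'a" and h where "A \<subseteq> X" "homeomorphism {0..1} A g h"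
      using assms(3) by (auto simp: free_arc_def)
    then have "g 0 \<in> X" "g 1 \<in> X" "h (g 0) = 0" "h (g 1) = 1"
      by (auto simp: homeomorphism_def)
    then show thesis using that by (metis zero_neq_one)
  qed
  define Z where "Z = blowup X m"
  have Z: "continuum Z" unfolding Z_def using assms(1) m(1) by (rule continuum_blowup)
  then have cZ: "compact Z" "Z \<noteq> {}" "connected Z" by (auto simp: continuum_def)
  obtain e :: "'a \<times> (nat \<Rightarrow> real) \<Rightarrow> nat \<Rightarrow> real" where e: "continuous_on Z e" "inj_on e Z"
    by (rule compact_embedding_real_sequences[OF cZ(1,2)])
  \<comment> \<open>Since \<open>p \<noteq> m\<close>, this is the only point of \<open>Z\<close>
    over \<open>p\<close>.\<close>
  define z where "z = (p, blowup_map m p)"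
  have z: "z \<in> Z" using assms(4) blowup_map_in[of m p] by (auto simp: Z_def z_def blowup_def)
  have Y: "continuum (e ` Z)"
    using cZ e(1) by (auto simp: continuum_def compact_continuous_image connected_continuous_image)
  have "subcontinua_at_top z Z homeomorphic_space subcontinua_at_top (fst z) X"
  proof (rule homeomorphic_hyperspaces[OF assms(1) Z])
    show "fst ` Z = X" unfolding Z_def by (rule fst_blowup)
    show "connected (Z \<inter> fst -` {x})" if "x \<in> X" for x
      unfolding Z_def using m(1) that by (rule connected_blowup_fibre)
    show "Z \<inter> fst -` B \<subseteq> closure {y \<in> Z. fst y \<in> B \<and> Z \<inter> fst -` {fst y} = {y}}"
      if "B \<in> subcontinua_at (fst z) X" for B
      unfolding Z_def
    proof (rule blowup_preimage_dense)
      show "connected B" "B \<subseteq> X" "p \<in> B"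
        using that by (auto simp: subcontinua_at_def subcontinua_def z_def dest: closedin_imp_subset)
    qed (use m in auto)
  qed (use z in \<open>auto intro!: continuous_intros\<close>)
  \<comment> \<open>\<open>e\<close> is injective, so every fibre is a single point and the density
    condition is immediate.\<close>
  moreover have "subcontinua_at_top z Z homeomorphic_space subcontinua_at_top (e z) (e ` Z)"
  proof (rule homeomorphic_hyperspaces[OF Y Z e(1) refl _ z])
    have fib: "Z \<inter> e -` {e y} = {y}" if "y \<in> Z" for y
      using that e(2) by (auto simp: inj_on_def)
    show "connected (Z \<inter> e -` {x})" if "x \<in> e ` Z" for x
      using that fib by auto
    show "Z \<inter> e -` B \<subseteq> closure {y \<in> Z. e y \<in> B \<and> Z \<inter> e -` {e y} = {y}}" for B
      by (rule order_trans[OF _ closure_subset]) (use fib in blast)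
  qed
  ultimately have "subcontinua_at_top p X homeomorphic_space subcontinua_at_top (e z) (e ` Z)"
    using homeomorphic_space_sym homeomorphic_space_trans unfolding z_def by (metis fst_conv)
  moreover have "\<not> hereditarily_decomposable (e ` Z)"
  proof
    assume hd: "hereditarily_decomposable (e ` Z)"
    \<comment> \<open>\<open>j\<close> embeds the copy of \<open>knaster\<close> over
      \<open>m\<close>, a nondegenerate indecomposable subcontinuum.\<close>
    define j where "j = e \<circ> Pair m"
    have sub: "Pair m ` knaster \<subseteq> Z" using m(1) by (auto simp: Z_def blowup_def)
    have cont: "continuous_on knaster j"
      unfolding j_def
      by (intro continuous_on_compose continuous_intros continuous_on_subset[OF e(1) sub])
    have inj: "inj_on j knaster"
      unfolding j_def using e(2) sub by (intro comp_inj_on) (auto simp: inj_on_def)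
    have "j ` knaster \<in> subcontinua (e ` Z)"
      using cont compact_knaster connected_knaster knaster_two_points(1) sub
      by (intro subcontinua_compactI compact_continuous_image connected_continuous_image)
         (auto simp: j_def)
    moreover have "j (\<lambda>_. 1) \<noteq> j (\<lambda>_. - 1 / 2)"
      using inj_on_eq_iff[OF inj knaster_two_points] by (auto simp: fun_eq_iff)
    moreover have "j (\<lambda>_. 1) \<in> j ` knaster" "j (\<lambda>_. - 1 / 2) \<in> j ` knaster"
      using knaster_two_points by blast+
    ultimately have "decomposable (j ` knaster)"
      using hd by (simp only: hereditarily_decomposable_def) metis
    then show False
      using decomposable_image[OF compact_knaster cont inj] knaster_indecomposable by blast
  qed
  ultimately show ?thesis using Y z by blast
qed

end
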